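(* Fix $\alpha\in(0,1)$ and suppose that (A2), (A4), (A5) and (A6) of the context hold. Consider $$\lim_{M\to\infty}FDP_M(\hat t_{\alpha,M}^0\mathbf w_M)\le\lim_{M\to\infty}FDP_M(\hat t_{\alpha,M}^\lambda\mathbf w_M)\le\alpha.\qquad( * )$$ Then: (C1) the first inequality in $( * )$ is satisfied almost surely. (C2) If, additionally, $\mu_0\le1$, then the second inequality in $( * )$ is satisfied almost surely. (C3) If, additionally, $\mu_0=1$ and $0<\alpha\le FDP_\infty(u)$, then the second inequality in $( * )$ is an equality almost surely under a Dirac Uniform (DU) distribution.
   Context: For each $M$ one tests null hypotheses $H_m$, $m\in\mathcal M=\{1,\dots,M\}$; $\mathcal M_0\subseteq\mathcal M$ indexes the true nulls, $M_0=|\mathcal M_0|$. Decision functions $\delta_m(t_m)=\delta_m(Z_m;t_m)\in\{0,1\}$ based on test statistics $Z_m$ satisfy the NS assumptions: for each $m$, $t_m\mapsto\delta_m(Z_m;t_m)$, $t_m\in[0,1]$, is almost surely nondecreasing and right continuous with $\delta_m=0$ at $t_m=0$ and $\delta_m=1$ at $t_m=1$; $t_m\mapsto E[\delta_m(Z_m;t_m)]$ is continuous and strictly increasing on $(0,1)$; and $E[\delta_m(Z_m;t_m)]=t_m$ for $m\in\mathcal M_0$. Equivalently $\delta_m(t_m)=I(P_m\le t_m)$ almost surely, with $P_m=\inf\{t_m\in[0,1]:\delta_m(Z_m;t_m)=1\}$; this form is used if an argument exceeds 1. $\mathbf w_M=(w_{m,M})_{m\in\mathcal M}$ are positive weights of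 mean 1, $w_{(M)}=\max_m w_{m,M}$, $\bar w_{0,M}=M_0^{-1}\sum_{m\in\mathcal M_0}w_{m,M}$. $R(t\mathbf w_M)=\sum_{m\in\mathcal M}\delta_m(tw_{m,M})$, $V(t\mathbf w_M)=\sum_{m\in\mathcal M_0}\delta_m(tw_{m,M})$, $FDP_M(t\mathbf w_M)=V(t\mathbf w_M)/\max\{R(t\mathbf w_M),1\}$. With tuning parameters $\lambda_M\in(0,1)$ and $\hat M_0(\lambda_M\mathbf w_M)=[M-R(\lambda_M\mathbf w_M)+1]/[1-\lambda_M]$, put $$\widehat{FDP}_M^0(t\mathbf w_M)=\frac{Mt}{\max\{R(t\mathbf w_M),1\}},\qquad \widehat{FDP}_M^\lambda(t\mathbf w_M)=\frac{\hat M_0(\lambda_M\mathbf w_M)\,t}{\max\{R(t\mathbf w_M),1\}},$$ $\hat t_{\alpha,M}^0=\sup\{0\le t\le u:\widehat{FDP}_M^0(t\mathbf w_M)\le\alpha\}$, $\hat t_{\alpha,M}^\lambda=\sup\{0\le t\le u:\widehat{FDP}_M^\lambda(t\mathbf w_M)\le\alpha\}$. Assumptions: (A2) $\lambda_M\to\lambda\le u=1/k$ almost surely, where $\lambda\in(0,1)$ and the constant $k$ satisfies $\lim_{M\to\infty}w_{(M)}\le k$ almost surely. (A4) for $t\in(0,u]$, $R(t\mathbf w_M)/M\to G(t)$ almost surely. (A5) for $t\in(0,u]$, $V(t\mathbf w_M)/M\to a_0\mu_0t$ almost surely, with $0<\mu_0<\infty$ and $0<a_0<1$, where $\bar w_{0,M}\to\mu_0$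 and $M_0/M\to a_0$ (almost surely). (A6) $t/G(t)$ is strictly increasing and continuous on $(0,u)$, with $\lim_{t\downarrow0}t/G(t)=0$ and $\lim_{t\uparrow u}t/G(t)=u/G(u)\le1$. $FDP_\infty(t)=a_0\mu_0t/G(t)$. A DU distribution is any distribution of the data with, for $t\in(0,1]$, $E[\delta_m(t)]=t$ if $m\in\mathcal M_0$ and $E[\delta_m(t)]=1$ otherwise (for $m\notin\mathcal M_0$ the strict monotonicity in the NS assumptions is then not required); under (A4)-(A5) it has $G(t)=a_0\mu_0t+(1-a_0)$ for $0<t\le u$, and in (C3) $FDP_\infty(u)$ is computed with this $G$.
   Formalization: In (A2) it is also assumed that almost surely λ_M ≤ u for all large M. This follows from λ_M → λ if λ < u; if λ = u the claims can fail without it, since (A4)–(A6) do not control R(t w_M) for t > u. *)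

theory Defs
  imports "HOL-Probability.Probability"
begin

text \<open>
  A decision function \<open>d z t\<close> is only specified for sizes \<open>t\<close> in the unit interval;
  \<open>decide\<close> extends it to \<open>t > 1\<close> through the p-value.
\<close>

definition p_value :: "('z \<Rightarrow> real \<Rightarrow> real) \<Rightarrow> 'z \<Rightarrow> real" where
  "p_value d z = Inf {t \<in> {0..1}. d z t = 1}"

definition decide :: "('z \<Rightarrow> real \<Rightarrow> real) \<Rightarrow> 'z \<Rightarrow> real \<Rightarrow> real" where
  "decide d z t = (if t \<le> 1 then d z t else of_bool (p_value d z \<le> t))"

text \<open>
  The realized decisions at the outcome \<open>\<omega>\<close> in the problem with \<open>M\<close> hypotheses, as a function
  of the hypothesis \<open>m\<close> and of the size. Test statistics and decision functions form a triangular
  array; a single sequence is the case where they do not depend on \<open>M\<close>.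
\<close>

definition decisions ::
  "(nat \<Rightarrow> nat \<Rightarrow> 'z \<Rightarrow> real \<Rightarrow> real) \<Rightarrow> (nat \<Rightarrow> nat \<Rightarrow> 'a \<Rightarrow> 'z) \<Rightarrow> nat \<Rightarrow> 'a \<Rightarrow> nat \<Rightarrow> real \<Rightarrow> real"
  where "decisions \<delta> Z M \<omega> m t = decide (\<delta> M m) (Z M m \<omega>) t"

text \<open>
  In the following, \<open>D m t\<close> are realized decisions, \<open>w m\<close> realized weights, \<open>M\<close> is the number of
  hypotheses and \<open>N\<close> the set of true nulls.
\<close>

definition rejections :: "(nat \<Rightarrow> real \<Rightarrow> real) \<Rightarrow> nat \<Rightarrow> (nat \<Rightarrow> real) \<Rightarrow> real \<Rightarrow> real" where
  "rejections D M w t = (\<Sum>m\<in>{1..M}. D m (t * w m))"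

definition false_rejections :: "(nat \<Rightarrow> real \<Rightarrow> real) \<Rightarrow> nat set \<Rightarrow> (nat \<Rightarrow> real) \<Rightarrow> real \<Rightarrow> real" where
  "false_rejections D N w t = (\<Sum>m\<in>N. D m (t * w m))"

definition FDP ::
  "(nat \<Rightarrow> real \<Rightarrow> real) \<Rightarrow> nat set \<Rightarrow> nat \<Rightarrow> (nat \<Rightarrow> real) \<Rightarrow> real \<Rightarrow> real" where
  "FDP D N M w t = false_rejections D N w t / max (rejections D M w t) 1"

definition M0_hat :: "(nat \<Rightarrow> real \<Rightarrow> real) \<Rightarrow> nat \<Rightarrow> (nat \<Rightarrow> real) \<Rightarrow> real \<Rightarrow> real" where
  "M0_hat D M w l = (real M - rejections D M w l + 1) / (1 - l)"

definition FDP_hat0 :: "(nat \<Rightarrow> real \<Rightarrow> real) \<Rightarrow> nat \<Rightarrow> (nat \<Rightarrow> real) \<Rightarrow> real \<Rightarrow> real" where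
  "FDP_hat0 D M w t = real M * t / max (rejections D M w t) 1"

definition FDP_hat ::
  "(nat \<Rightarrow> real \<Rightarrow> real) \<Rightarrow> nat \<Rightarrow> (nat \<Rightarrow> real) \<Rightarrow> real \<Rightarrow> real \<Rightarrow> real" where
  "FDP_hat D M w l t = M0_hat D M w l * t / max (rejections D M w t) 1"

definition t_hat0 ::
  "(nat \<Rightarrow> real \<Rightarrow> real) \<Rightarrow> nat \<Rightarrow> (nat \<Rightarrow> real) \<Rightarrow> real \<Rightarrow> real \<Rightarrow> real" where
  "t_hat0 D M w u \<alpha> = Sup {t. 0 \<le> t \<and> t \<le> u \<and> FDP_hat0 D M w t \<le> \<alpha>}"

definition t_hat ::
  "(nat \<Rightarrow> real \<Rightarrow> real) \<Rightarrow> nat \<Rightarrow> (nat \<Rightarrow> real) \<Rightarrow> real \<Rightarrow> real \<Rightarrow> real \<Rightarrow> real" where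
  "t_hat D M w l u \<alpha> = Sup {t. 0 \<le> t \<and> t \<le> u \<and> FDP_hat D M w l t \<le> \<alpha>}"

text \<open>The false discovery proportions actually attained at the two estimated thresholds.\<close>

definition procedure_FDP0 ::
  "(nat \<Rightarrow> nat \<Rightarrow> 'z \<Rightarrow> real \<Rightarrow> real) \<Rightarrow> (nat \<Rightarrow> nat \<Rightarrow> 'a \<Rightarrow> 'z) \<Rightarrow> (nat \<Rightarrow> nat set) \<Rightarrow>
   (nat \<Rightarrow> 'a \<Rightarrow> nat \<Rightarrow> real) \<Rightarrow> real \<Rightarrow> real \<Rightarrow> nat \<Rightarrow> 'a \<Rightarrow> real" where
  "procedure_FDP0 \<delta> Z N w u \<alpha> M \<omega> =
     FDP (decisions \<delta> Z M \<omega>) (N M) M (w M \<omega>) (t_hat0 (decisions \<delta> Z M \<omega>) M (w M \<omega>) u \<alpha>)"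

definition procedure_FDP ::
  "(nat \<Rightarrow> nat \<Rightarrow> 'z \<Rightarrow> real \<Rightarrow> real) \<Rightarrow> (nat \<Rightarrow> nat \<Rightarrow> 'a \<Rightarrow> 'z) \<Rightarrow> (nat \<Rightarrow> nat set) \<Rightarrow>
   (nat \<Rightarrow> 'a \<Rightarrow> nat \<Rightarrow> real) \<Rightarrow> (nat \<Rightarrow> 'a \<Rightarrow> real) \<Rightarrow> real \<Rightarrow> real \<Rightarrow> nat \<Rightarrow> 'a \<Rightarrow> real" where
  "procedure_FDP \<delta> Z N w lam u \<alpha> M \<omega> =
     FDP (decisions \<delta> Z M \<omega>) (N M) M (w M \<omega>)
       (t_hat (decisions \<delta> Z M \<omega>) M (w M \<omega>) (lam M \<omega>) u \<alpha>)"

definition FDP_inf :: "real \<Rightarrow> real \<Rightarrow> (real \<Rightarrow> real) \<Rightarrow> real \<Rightarrow> real" where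
  "FDP_inf a0 \<mu>0 G t = a0 * \<mu>0 * t / G t"

definition dirac_uniform ::
  "'a measure \<Rightarrow> (nat \<Rightarrow> nat \<Rightarrow> 'a \<Rightarrow> 'z) \<Rightarrow> (nat \<Rightarrow> nat \<Rightarrow> 'z \<Rightarrow> real \<Rightarrow> real) \<Rightarrow> (nat \<Rightarrow> nat set) \<Rightarrow> bool"
  where
  "dirac_uniform P Z \<delta> N \<longleftrightarrow>
     (\<forall>M. \<forall>m\<in>{1..M}. \<forall>t\<in>{0<..1}.
        (\<integral>\<omega>. \<delta> M m (Z M m \<omega>) t \<partial>P) = (if m \<in> N M then t else 1))"

text \<open>
  The requirements on a decision function that a Dirac Uniform distribution cannot meet outside the
  nulls. There the expectation is \<open>1\<close> on all of \<open>(0,1]\<close>, so it is not strictly increasing, and the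
  decision is almost surely \<open>1\<close> at every positive size, so it cannot both vanish at \<open>0\<close> and be
  right continuous at \<open>0\<close>.
\<close>

definition nondegenerate ::
  "'a measure \<Rightarrow> ('a \<Rightarrow> 'z) \<Rightarrow> ('z \<Rightarrow> real \<Rightarrow> real) \<Rightarrow> bool" where
  "nondegenerate P X d \<longleftrightarrow>
     (AE \<omega> in P. d (X \<omega>) 0 = 0 \<and> continuous (at_right 0) (d (X \<omega>))) \<and>
     strict_mono_on {0<..<1} (\<lambda>t. \<integral>\<omega>. d (X \<omega>) t \<partial>P)"

text \<open>
  Null sets are deterministic; weights and tuning parameters may be random and may depend on the
  data.
\<close>

locale weighted_testing = prob_space P
  for P :: "'a measure" +
  fixes S :: "nat \<Rightarrow> nat \<Rightarrow> 'z measure"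
    and Z :: "nat \<Rightarrow> nat \<Rightarrow> 'a \<Rightarrow> 'z"
    and \<delta> :: "nat \<Rightarrow> nat \<Rightarrow> 'z \<Rightarrow> real \<Rightarrow> real"
    and N :: "nat \<Rightarrow> nat set"
    and w :: "nat \<Rightarrow> 'a \<Rightarrow> nat \<Rightarrow> real"
    and lam :: "nat \<Rightarrow> 'a \<Rightarrow> real"
  assumes nulls: "N M \<subseteq> {1..M}"
    and statistic: "m \<in> {1..M} \<Longrightarrow> Z M m \<in> measurable P (S M m)"
    and decision_measurable:
      "m \<in> {1..M} \<Longrightarrow> t \<in> {0..1} \<Longrightarrow> (\<lambda>z. \<delta> M m z t) \<in> borel_measurable (S M m)"
    and decision_01:
      "m \<in> {1..M} \<Longrightarrow> z \<in> space (S M m) \<Longrightarrow> t \<in> {0..1} \<Longrightarrow> \<delta> M m z t \<in> {0, 1}"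
    and decision_mono:
      "m \<in> {1..M} \<Longrightarrow> AE \<omega> in P. mono_on {0..1} (\<delta> M m (Z M m \<omega>))"
    and decision_right_continuous:
      "m \<in> {1..M} \<Longrightarrow> AE \<omega> in P. \<forall>t\<in>{0<..<1}. continuous (at_right t) (\<delta> M m (Z M m \<omega>))"
    and decision_at_1:
      "m \<in> {1..M} \<Longrightarrow> AE \<omega> in P. \<delta> M m (Z M m \<omega>) 1 = 1"
    and size_continuous:
      "m \<in> {1..M} \<Longrightarrow> continuous_on {0<..<1} (\<lambda>t. expectation (\<lambda>\<omega>. \<delta> M m (Z M m \<omega>) t))"
    and size_null:
      "m \<in> N M \<Longrightarrow> t \<in> {0..1} \<Longrightarrow> expectation (\<lambda>\<omega>. \<delta> M m (Z M m \<omega>) t) = t"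
    and null_nondegenerate:
      "m \<in> N M \<Longrightarrow> nondegenerate P (Z M m) (\<delta> M m)"
    and alternative_nondegenerate:
      "dirac_uniform P Z \<delta> N \<or>
       (\<forall>M. \<forall>m\<in>{1..M} - N M. nondegenerate P (Z M m) (\<delta> M m))"
    and weight_measurable: "m \<in> {1..M} \<Longrightarrow> random_variable borel (\<lambda>\<omega>. w M \<omega> m)"
    and weight_pos: "m \<in> {1..M} \<Longrightarrow> \<omega> \<in> space P \<Longrightarrow> 0 < w M \<omega> m"
    and weight_mean: "1 \<le> M \<Longrightarrow> \<omega> \<in> space P \<Longrightarrow> (\<Sum>m\<in>{1..M}. w M \<omega> m) / real M = 1"
    and lam_measurable: "random_variable borel (lam M)"
    and lam_bounds: "\<omega> \<in> space P \<Longrightarrow> 0 < lam M \<omega> \<and> lam M \<omega> < 1"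

end

(*
  Outside a single null set, R/M and V/M are monotone in t and converge, at the rationals in (0,u] and
  at u, to the continuous limits G(t) and a0 mu0 t; monotonicity upgrades this to convergence along
  every convergent sequence of arguments. Hence M0_hat/M tends to c = (1 - G(lam)) / (1 - lam), both
  thresholds converge, and with F(t) = t/G(t) the attained proportions tend to a0 mu0 F(t0) and
  a0 mu0 F(t1), where t0 and t1 are the largest points of (0,u] with F(t0) <= alpha and
  c F(t1) <= alpha.
  Since F <= 1, c <= 1 and so t0 <= t1. Counting alternatives, G(lam) <= a0 mu0 lam + 1 - a0, which
  for mu0 <= 1 gives c >= a0 >= a0 mu0; under a Dirac Uniform distribution with mu0 = 1, c = a0.
*)
theory Submission
  imports Defs
begin

section \<open>Convergence of monotone functions along sequences\<close>

text \<open>Continuity of \<open>g\<close> provides a rational \<open>q\<close> on either side of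
  \<open>t\<close>, close enough that \<open>g q\<close> is still on the right side of
  \<open>a\<close>. Eventually \<open>x n\<close> lies beyond \<open>q\<close>, and monotonicity
  transfers the bound from \<open>f n q\<close> to \<open>f n (x n)\<close>. Only countably many
  points are consulted, so almost sure pointwise limits suffice.\<close>

lemma tendsto_mono_on_dense:
  fixes f :: "nat \<Rightarrow> real \<Rightarrow> real" and g :: "real \<Rightarrow> real"
  assumes mono: "\<And>n. mono_on {0<..u} (f n)"
    and lim: "\<And>q. q \<in> {0<..u} \<Longrightarrow> q \<in> \<rat> \<or> q = u \<Longrightarrow> (\<lambda>n. f n q) \<longlonglongrightarrow> g q"
    and cont: "continuous_on {0<..u} g"
    and t: "t \<in> {0<..u}"
    and x: "x \<longlonglongrightarrow> t" "\<forall>\<^sub>F n in sequentially. x n \<in> {0<..u}"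
  shows "(\<lambda>n. f n (x n)) \<longlonglongrightarrow> g t"
proof (rule order_tendstoI)
  fix a assume a: "a < g t"
  have "\<forall>\<^sub>F y in at t within {0<..u}. a < g y"
    using cont t a by (auto simp: continuous_on_def intro: order_tendstoD)
  then obtain d where d: "d > 0" "\<And>y. y \<in> {0<..u} \<Longrightarrow> y \<noteq> t \<Longrightarrow> dist y t < d \<Longrightarrow> a < g y"
    unfolding eventually_at by blast
  obtain q where q: "q \<in> \<rat>" "max 0 (t - d) < q" "q < t"
    using Rats_dense_in_real[of "max 0 (t - d)" t] d t by auto
  have qS: "q \<in> {0<..u}" using q t by auto
  have "a < g q" using d(2)[OF qS] q by (auto simp: dist_real_def)
  then have "\<forall>\<^sub>F n in sequentially. a < f n q"
    using lim[OF qS] q by (auto intro: order_tendstoD)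
  moreover have "\<forall>\<^sub>F n in sequentially. q < x n" using x(1) q(3) by (rule order_tendstoD)
  ultimately show "\<forall>\<^sub>F n in sequentially. a < f n (x n)"
    using x(2)
  proof eventually_elim
    case (elim n)
    have "f n q \<le> f n (x n)" using mono_onD[OF mono qS elim(3)] elim(2) by simp
    then show ?case using elim by simp
  qed
next
  fix a assume a: "g t < a"
  \<comment> \<open>At \<open>t = u\<close> there is no room on the right; \<open>u\<close> itself
    then serves as \<open>q\<close>, which is why the limit is also assumed at
    \<open>u\<close>.\<close>
  obtain q where q: "q \<in> {0<..u}" "q \<in> \<rat> \<or> q = u" "g q < a" "\<forall>\<^sub>F n in sequentially. x n \<le> q"
  proof (cases "t = u")
    case True
    moreover have "\<forall>\<^sub>F n in sequentially. x n \<le> u" using x(2) by eventually_elim simp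
    ultimately show ?thesis using that[of u] a t by auto
  next
    case False
    have "\<forall>\<^sub>F y in at t within {0<..u}. g y < a"
      using cont t a by (auto simp: continuous_on_def intro: order_tendstoD)
    then obtain d where d: "d > 0" "\<And>y. y \<in> {0<..u} \<Longrightarrow> y \<noteq> t \<Longrightarrow> dist y t < d \<Longrightarrow> g y < a"
      unfolding eventually_at by blast
    obtain q where q: "q \<in> \<rat>" "t < q" "q < min u (t + d)"
      using Rats_dense_in_real[of t "min u (t + d)"] d t False by auto
    have qS: "q \<in> {0<..u}" using q t by auto
    have "g q < a" using d(2)[OF qS] q by (auto simp: dist_real_def)
    moreover have "\<forall>\<^sub>F n in sequentially. x n \<le> q"
      using order_tendstoD(2)[OF x(1) q(2)] by eventually_elim simp
    ultimately show ?thesis using that qS q(1) by blast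
  qed
  have "\<forall>\<^sub>F n in sequentially. f n q < a"
    using lim[OF q(1,2)] q(3) by (auto intro: order_tendstoD)
  then show "\<forall>\<^sub>F n in sequentially. f n (x n) < a"
    using q(4) x(2)
  proof eventually_elim
    case (elim n)
    have "f n (x n) \<le> f n q" using mono_onD[OF mono elim(3) q(1) elim(2)] .
    then show ?case using elim by simp
  qed
qed

section \<open>The limiting ratio\<close>

locale limiting_ratio =
  fixes G :: "real \<Rightarrow> real" and u :: real
  assumes u_pos: "0 < u"
    and ratio_mono: "strict_mono_on {0<..<u} (\<lambda>t. t / G t)"
    and ratio_cont: "continuous_on {0<..<u} (\<lambda>t. t / G t)"
    and ratio_at_0: "((\<lambda>t. t / G t) \<longlongrightarrow> 0) (at_right 0)"
    and ratio_at_u: "((\<lambda>t. t / G t) \<longlongrightarrow> u / G u) (at_left u)"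
begin

text \<open>The value at \<open>u\<close> is tied to the open interval only through a left limit.
  The midpoint \<open>r\<close> keeps the inequality strict when passing to that limit.\<close>

lemma ratio_less:
  assumes "0 < s" "s < t" "t \<le> u"
  shows "s / G s < t / G t"
proof (cases "t = u")
  case False
  then show ?thesis using strict_mono_onD[OF ratio_mono, of s t] assms by auto
next
  case True
  define r where "r = (s + u) / 2"
  have r: "s < r" "r < u" using assms True by (auto simp: r_def)
  have "s / G s < r / G r" using strict_mono_onD[OF ratio_mono, of s r] assms r by auto
  also have "r / G r \<le> u / G u"
  proof (rule tendsto_lowerbound[OF ratio_at_u])
    have "\<forall>\<^sub>F x in at_left u. x \<in> {r<..<u}"
      using r(2) by (rule eventually_at_left_real)
    then show "\<forall>\<^sub>F x in at_left u. r / G r \<le> x / G x"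
    proof eventually_elim
      case (elim x)
      then show ?case using strict_mono_onD[OF ratio_mono, of r x] assms r by auto
    qed
  qed simp
  finally show ?thesis using True by simp
qed

text \<open>An increasing function stays above its limit 0 at the origin; comparing with
  \<open>t/2\<close> first makes the bound strict. Strictness also excludes \<open>G t = 0\<close>,
  where the quotient would take the default value 0.\<close>

lemma ratio_pos:
  assumes "0 < t" "t \<le> u"
  shows "0 < t / G t"
proof -
  have "0 \<le> (t/2) / G (t/2)"
  proof (rule tendsto_upperbound[OF ratio_at_0])
    have "\<forall>\<^sub>F x in at_right 0. x \<in> {0<..<t/2}"
      using assms by (intro eventually_at_right_real) auto
    then show "\<forall>\<^sub>F x in at_right 0. x / G x \<le> (t/2) / G (t/2)"
    proof eventually_elim
      case (elim x)
      then show ?case using ratio_less[of x "t/2"] assms by auto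
    qed
  qed simp
  also have "\<dots> < t / G t" using ratio_less[of "t/2" t] assms by auto
  finally show ?thesis .
qed

lemma G_pos: "0 < t \<Longrightarrow> t \<le> u \<Longrightarrow> 0 < G t"
  using ratio_pos[of t] by (simp add: zero_less_divide_iff)

lemma ratio_continuous: "continuous_on {0<..u} (\<lambda>t. t / G t)"
  unfolding continuous_on_def
proof
  fix t assume t: "t \<in> {0<..u}"
  show "((\<lambda>t. t / G t) \<longlongrightarrow> t / G t) (at t within {0<..u})"
  proof (cases "t = u")
    case True
    have "((\<lambda>t. t / G t) \<longlongrightarrow> u / G u) (at u within {0<..u})"
    \<comment> \<open>Punctured neighbourhoods of \<open>u\<close> inside \<open>{0<..u}\<close>
      only contain points below \<open>u\<close>, so the left limit is enough.\<close>
    proof (rule tendsto_mono[OF _ ratio_at_u], rule filter_leI)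
      show "\<forall>\<^sub>F x in at u within {0<..u}. Q x" if "eventually Q (at_left u)" for Q
        using that by (force simp: eventually_at)
    qed
    then show ?thesis using True by simp
  next
    case False
    then have "isCont (\<lambda>t. t / G t) t"
      using ratio_cont t continuous_on_eq_continuous_at[OF open_greaterThanLessThan] by force
    then show ?thesis by (auto simp: isCont_def intro: tendsto_within_subset)
  qed
qed

text \<open>\<open>G\<close> is recovered as \<open>t\<close> divided by the continuous,
  nonvanishing ratio.\<close>

lemma G_continuous: "continuous_on {0<..u} G"
proof -
  have "t / G t \<noteq> 0" if "t \<in> {0<..u}" for t
    using G_pos[of t] that by auto
  then have "continuous_on {0<..u} (\<lambda>t. t / (t / G t))"
    by (intro continuous_on_divide continuous_on_id ratio_continuous) blast
  then show ?thesis by (rule continuous_on_eq) simp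
qed

end

section \<open>Convergence of the thresholds on one sample path\<close>

text \<open>One fixed outcome: \<open>R\<close> and \<open>V\<close> are the realized counts, and
  \<open>b\<close> stands for \<open>a0 * \<mu>0\<close>.\<close>

locale testing_path = limiting_ratio +
  fixes R V :: "nat \<Rightarrow> real \<Rightarrow> real" and b :: real
  assumes R_mono: "mono_on {0<..u} (R n)"
    and V_mono: "mono_on {0<..u} (V n)"
    and R_lim: "q \<in> {0<..u} \<Longrightarrow> q \<in> \<rat> \<or> q = u \<Longrightarrow> (\<lambda>n. R n q / real n) \<longlonglongrightarrow> G q"
    and V_lim: "q \<in> {0<..u} \<Longrightarrow> q \<in> \<rat> \<or> q = u \<Longrightarrow> (\<lambda>n. V n q / real n) \<longlonglongrightarrow> b * q"
begin

text \<open>Common form of both estimated thresholds: \<open>A n = n\<close> gives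
  \<open>t_hat0\<close>, and \<open>A n\<close> equal to the value of \<open>M0_hat\<close> gives
  \<open>t_hat\<close>.\<close>

definition threshold :: "(nat \<Rightarrow> real) \<Rightarrow> real \<Rightarrow> nat \<Rightarrow> real" where
  "threshold A \<alpha> n = Sup {t. 0 \<le> t \<and> t \<le> u \<and> A n * t / max (R n t) 1 \<le> \<alpha>}"

text \<open>The reindexing \<open>r\<close> allows passing to subsequences, as the compactness
  argument for the thresholds requires.\<close>

lemma R_seq:
  assumes "filterlim r at_top sequentially" "t \<in> {0<..u}"
    and "x \<longlonglongrightarrow> t" "\<forall>\<^sub>F n in sequentially. x n \<in> {0<..u}"
  shows "(\<lambda>n. R (r n) (x n) / real (r n)) \<longlonglongrightarrow> G t"
proof (rule tendsto_mono_on_dense[OF _ _ G_continuous assms(2-4)])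
  show "mono_on {0<..u} (\<lambda>t. R (r n) t / real (r n))" for n
    using R_mono[of "r n"] by (auto simp: mono_on_def intro!: divide_right_mono)
  show "(\<lambda>n. R (r n) q / real (r n)) \<longlonglongrightarrow> G q" if "q \<in> {0<..u}" "q \<in> \<rat> \<or> q = u" for q
    using filterlim_compose[OF R_lim[OF that] assms(1)] .
qed

lemma V_seq:
  assumes "t \<in> {0<..u}"
    and "x \<longlonglongrightarrow> t" "\<forall>\<^sub>F n in sequentially. x n \<in> {0<..u}"
  shows "(\<lambda>n. V n (x n) / real n) \<longlonglongrightarrow> b * t"
proof (rule tendsto_mono_on_dense[OF _ _ _ assms])
  show "mono_on {0<..u} (\<lambda>t. V n t / real n)" for n
    using V_mono[of n] by (auto simp: mono_on_def intro!: divide_right_mono)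
qed (auto intro!: V_lim continuous_intros)

text \<open>After scaling, the truncation at 1 becomes \<open>1 / r n\<close>, which vanishes in the
  limit because \<open>G t\<close> is positive.\<close>

lemma denominator_seq:
  assumes "filterlim r at_top sequentially" "t \<in> {0<..u}"
    and "x \<longlonglongrightarrow> t" "\<forall>\<^sub>F n in sequentially. x n \<in> {0<..u}"
  shows "(\<lambda>n. max (R (r n) (x n)) 1 / real (r n)) \<longlonglongrightarrow> G t"
proof -
  have "(\<lambda>n. 1 / real (r n)) \<longlonglongrightarrow> 0"
    using filterlim_compose[OF lim_1_over_n assms(1)] .
  with R_seq[OF assms]
  have "(\<lambda>n. max (R (r n) (x n) / real (r n)) (1 / real (r n))) \<longlonglongrightarrow> max (G t) 0"
    by (rule tendsto_max)
  moreover have "max (G t) 0 = G t" using G_pos[of t] assms(2) by auto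
  moreover have "max (R (r n) (x n) / real (r n)) (1 / real (r n))
      = max (R (r n) (x n)) 1 / real (r n)" for n
    by (simp add: max_divide_distrib_right)
  ultimately show ?thesis by simp
qed

lemma estimate_seq:
  assumes "filterlim r at_top sequentially" "t \<in> {0<..u}"
    and "x \<longlonglongrightarrow> t" "\<forall>\<^sub>F n in sequentially. x n \<in> {0<..u}"
    and A: "(\<lambda>n. A n / real n) \<longlonglongrightarrow> c"
  shows "(\<lambda>n. A (r n) * x n / max (R (r n) (x n)) 1) \<longlonglongrightarrow> c * (t / G t)"
proof -
  have "(\<lambda>n. (A (r n) / real (r n)) * x n / (max (R (r n) (x n)) 1 / real (r n)))
      \<longlonglongrightarrow> c * t / G t"
    using G_pos[of t] assms(2)
    by (intro tendsto_intros filterlim_compose[OF A assms(1)] assms(3) denominator_seq assms) auto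
  moreover have "\<forall>\<^sub>F n in sequentially. r n > 0"
    by (rule eventually_compose_filterlim[OF eventually_gt_at_top assms(1)])
  then have "\<forall>\<^sub>F n in sequentially.
      (A (r n) / real (r n)) * x n / (max (R (r n) (x n)) 1 / real (r n))
      = A (r n) * x n / max (R (r n) (x n)) 1"
    by eventually_elim (simp add: divide_simps)
  ultimately have "(\<lambda>n. A (r n) * x n / max (R (r n) (x n)) 1) \<longlonglongrightarrow> c * t / G t"
    by (rule Lim_transform_eventually)
  then show ?thesis by simp
qed

section \<open>Existence and convergence of the thresholds\<close>

lemma threshold_bounds:
  assumes "0 < \<alpha>"
  shows "threshold A \<alpha> n \<le> u"
    and "0 \<le> t \<Longrightarrow> t \<le> u \<Longrightarrow> A n * t / max (R n t) 1 \<le> \<alpha> \<Longrightarrow> t \<le> threshold A \<alpha> n"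
proof -
  \<comment> \<open>The point 0 is always admissible since \<open>\<alpha>\<close> is positive, so
    the supremum is never that of an empty set.\<close>
  have "0 \<in> {t. 0 \<le> t \<and> t \<le> u \<and> A n * t / max (R n t) 1 \<le> \<alpha>}"
    using assms u_pos by simp
  then show "threshold A \<alpha> n \<le> u"
    unfolding threshold_def by (intro cSup_least) auto
  show "t \<le> threshold A \<alpha> n" if "0 \<le> t" "t \<le> u" "A n * t / max (R n t) 1 \<le> \<alpha>"
    unfolding threshold_def using that by (intro cSup_upper) (auto simp: bdd_above_def)
qed

lemma threshold_witness:
  assumes "0 < \<alpha>" "s < threshold A \<alpha> n"
  obtains t where "s < t" "t \<le> u" "A n * t / max (R n t) 1 \<le> \<alpha>"
proof -
  have "\<exists>t \<in> {t. 0 \<le> t \<and> t \<le> u \<and> A n * t / max (R n t) 1 \<le> \<alpha>}. s < t"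
  proof (rule less_cSupD)
    have "0 \<in> {t. 0 \<le> t \<and> t \<le> u \<and> A n * t / max (R n t) 1 \<le> \<alpha>}"
      using assms u_pos by simp
    then show "{t. 0 \<le> t \<and> t \<le> u \<and> A n * t / max (R n t) 1 \<le> \<alpha>} \<noteq> {}" by blast
    show "s < Sup {t. 0 \<le> t \<and> t \<le> u \<and> A n * t / max (R n t) 1 \<le> \<alpha>}"
      using assms(2) unfolding threshold_def .
  qed
  then show ?thesis using that by blast
qed

text \<open>Either \<open>u\<close> is admissible, or the ratio climbs continuously from near 0 to
  above \<open>\<alpha>\<close> and the intermediate value theorem applies. By strict monotonicity
  the last property makes \<open>t\<close> the largest admissible point.\<close>

lemma limit_threshold_exists:
  assumes "0 < \<alpha>" "0 \<le> c"
  obtains t where "t \<in> {0<..u}" "c * (t / G t) \<le> \<alpha>" "t = u \<or> c * (t / G t) = \<alpha>"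
proof (cases "c * (u / G u) \<le> \<alpha>")
  case True
  then show ?thesis using that[of u] u_pos by auto
next
  case False
  have "((\<lambda>t. c * (t / G t)) \<longlongrightarrow> c * 0) (at_right 0)"
    by (intro tendsto_intros ratio_at_0)
  then have "\<forall>\<^sub>F t in at_right 0. c * (t / G t) < \<alpha>"
    using assms by (intro order_tendstoD) auto
  moreover have "\<forall>\<^sub>F t in at_right 0. t \<in> {0<..<u}"
    using u_pos by (rule eventually_at_right_real)
  ultimately have "\<forall>\<^sub>F t in at_right 0. t \<in> {0<..<u} \<and> c * (t / G t) < \<alpha>"
    by eventually_elim simp
  then obtain e where e: "e \<in> {0<..<u}" "c * (e / G e) < \<alpha>"
    using eventually_happens[of _ "at_right (0::real)"] by auto
  have "continuous_on {e..u} (\<lambda>t. c * (t / G t))"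
    using e by (intro continuous_on_mult_left continuous_on_subset[OF ratio_continuous]) auto
  then obtain t where "e \<le> t" "t \<le> u" "c * (t / G t) = \<alpha>"
    using IVT'[of "\<lambda>t. c * (t / G t)" e \<alpha> u] e False by auto
  then show ?thesis using that[of t] e by auto
qed

text \<open>Each fixed point below \<open>t\<close> has limiting estimate under
  \<open>\<alpha>\<close> and is eventually admissible. The estimates need not be monotone, so the
  upper bound uses compactness: infinitely many thresholds above \<open>a\<close> would yield
  admissible points accumulating at some \<open>l > t\<close> with
  \<open>c * (l / G l) \<le> \<alpha>\<close>.\<close>

lemma threshold_tendsto:
  assumes A: "(\<lambda>n. A n / real n) \<longlonglongrightarrow> c"
    and \<alpha>: "0 < \<alpha>" and c: "0 \<le> c"
    and t: "t \<in> {0<..u}" "c * (t / G t) \<le> \<alpha>" "t = u \<or> c * (t / G t) = \<alpha>"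
  shows "threshold A \<alpha> \<longlonglongrightarrow> t"
proof (rule order_tendstoI)
  fix a assume "a < t"
  \<comment> \<open>The maximum with 0 keeps \<open>s\<close> positive even if \<open>a\<close> is
    negative.\<close>
  define s where "s = (max a 0 + t) / 2"
  have s: "a < s" "0 < s" "s < t" using \<open>a < t\<close> t(1) by (auto simp: s_def)
  have lt: "c * (s / G s) < \<alpha>"
  proof (cases "c = 0")
    case False
    then have "c * (s / G s) < c * (t / G t)"
      using ratio_less[of s t] s t c by (intro mult_strict_left_mono) auto
    then show ?thesis using t(2) by simp
  qed (use \<alpha> in simp)
  have "(\<lambda>n. A n * s / max (R n s) 1) \<longlonglongrightarrow> c * (s / G s)"
    using estimate_seq[OF filterlim_ident _ tendsto_const _ A, of s] s t by auto
  from order_tendstoD(2)[OF this lt] show "\<forall>\<^sub>F n in sequentially. a < threshold A \<alpha> n"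
  proof eventually_elim
    case (elim n)
    then have "s \<le> threshold A \<alpha> n"
      using threshold_bounds(2)[OF \<alpha>, of s] s t by auto
    then show ?case using s by simp
  qed
next
  fix a assume "t < a"
  show "\<forall>\<^sub>F n in sequentially. threshold A \<alpha> n < a"
  proof (cases "u < a")
    case True
    then show ?thesis using threshold_bounds(1)[OF \<alpha>] by (auto intro: le_less_trans always_eventually)
  next
    case False
    \<comment> \<open>A level strictly between \<open>t\<close> and \<open>a\<close>: thresholds at
      least \<open>a\<close> strictly exceed it, so admissible witnesses above it exist.\<close>
    define d where "d = (t + a) / 2"
    have d: "t < d" "d < a" "d \<le> u" "0 < d" using \<open>t < a\<close> False t(1) by (auto simp: d_def)
    \<comment> \<open>Here \<open>t < a \<le> u\<close> excludes the alternative
      \<open>t = u\<close>; the equality in turn forces \<open>c\<close> to be nonzero.\<close>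
    have eq: "c * (t / G t) = \<alpha>" using t(3) \<open>t < a\<close> False by auto
    then have c_pos: "0 < c" using \<alpha> c by (cases "c = 0") auto
    show ?thesis
    proof (rule ccontr)
      assume "\<not> ?thesis"
      then obtain r :: "nat \<Rightarrow> nat" where r: "strict_mono r" "\<And>n. \<not> threshold A \<alpha> (r n) < a"
        using not_eventually_sequentiallyD by blast
      have "\<exists>s. d < s \<and> s \<le> u \<and> A (r n) * s / max (R (r n) s) 1 \<le> \<alpha>" for n
      proof -
        have "d < threshold A \<alpha> (r n)" using r(2)[of n] d by simp
        then show ?thesis by (rule threshold_witness[OF \<alpha>]) blast
      qed
      then obtain s where s: "\<And>n. d < s n" "\<And>n. s n \<le> u"
          "\<And>n. A (r n) * s n / max (R (r n) (s n)) 1 \<le> \<alpha>"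
        by metis
      have "\<forall>n. s n \<in> {d..u}" using s by (auto intro: less_imp_le)
      \<comment> \<open>The witnesses stay in \<open>[d, u]\<close>, away from 0, so their limit
        point lies in the range where \<open>estimate_seq\<close> applies.\<close>
      then obtain l p where l: "l \<in> {d..u}" "strict_mono p" "(s \<circ> p) \<longlonglongrightarrow> l"
        using compact_Icc[of d u] unfolding compact_def by metis
      have rp: "filterlim (\<lambda>n. r (p n)) at_top sequentially"
        using filterlim_subseq[OF strict_mono_o[OF r(1) l(2)]] by (simp add: o_def)
      have "(\<lambda>n. A (r (p n)) * s (p n) / max (R (r (p n)) (s (p n))) 1) \<longlonglongrightarrow> c * (l / G l)"
        using l d s by (intro estimate_seq[OF rp _ _ _ A])
          (auto simp: o_def intro!: always_eventually less_trans[OF d(4)])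
      then have "c * (l / G l) \<le> \<alpha>"
        by (rule LIMSEQ_le_const2) (use s in auto)
      moreover have "c * (t / G t) < c * (l / G l)"
        using ratio_less[of t l] l d t c_pos by (intro mult_strict_left_mono) auto
      ultimately show False using eq by simp
    qed
  qed
qed

section \<open>Limits of the attained proportions\<close>

lemma attained_tendsto:
  assumes A: "(\<lambda>n. A n / real n) \<longlonglongrightarrow> c"
    and \<alpha>: "0 < \<alpha>" and c: "0 \<le> c"
    and t: "t \<in> {0<..u}" "c * (t / G t) \<le> \<alpha>" "t = u \<or> c * (t / G t) = \<alpha>"
  shows "(\<lambda>n. V n (threshold A \<alpha> n) / max (R n (threshold A \<alpha> n)) 1) \<longlonglongrightarrow> b * (t / G t)"
proof -
  let ?x = "threshold A \<alpha>"
  note lim = threshold_tendsto[OF assms]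
  have "\<forall>\<^sub>F n in sequentially. 0 < ?x n"
    using lim t(1) by (intro order_tendstoD) auto
  then have ev: "\<forall>\<^sub>F n in sequentially. ?x n \<in> {0<..u}"
    by eventually_elim (simp add: threshold_bounds(1)[OF \<alpha>])
  have "(\<lambda>n. (V n (?x n) / real n) / (max (R n (?x n)) 1 / real n)) \<longlonglongrightarrow> (b * t) / G t"
    using G_pos[of t] t
    by (intro tendsto_divide V_seq lim ev denominator_seq[OF filterlim_ident]) auto
  moreover have "\<forall>\<^sub>F n in sequentially. (V n (?x n) / real n) / (max (R n (?x n)) 1 / real n)
      = V n (?x n) / max (R n (?x n)) 1"
    using eventually_gt_at_top[of 0] by eventually_elim simp
  ultimately have "(\<lambda>n. V n (?x n) / max (R n (?x n)) 1) \<longlonglongrightarrow> (b * t) / G t"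
    by (rule Lim_transform_eventually)
  then show ?thesis by simp
qed

lemma M0_hat_tendsto:
  assumes l: "l \<longlonglongrightarrow> \<nu>" "\<forall>\<^sub>F n in sequentially. l n \<in> {0<..u}"
    and \<nu>: "\<nu> \<in> {0<..u}" "\<nu> < 1"
  shows "(\<lambda>n. (real n - R n (l n) + 1) / (1 - l n) / real n) \<longlonglongrightarrow> (1 - G \<nu>) / (1 - \<nu>)"
proof -
  have "(\<lambda>n. (1 - R n (l n) / real n + 1 / real n) / (1 - l n)) \<longlonglongrightarrow> (1 - G \<nu> + 0) / (1 - \<nu>)"
    using \<nu> by (intro tendsto_intros R_seq[OF filterlim_ident] l lim_1_over_n) auto
  moreover have "\<forall>\<^sub>F n in sequentially. (1 - R n (l n) / real n + 1 / real n) / (1 - l n)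
      = (real n - R n (l n) + 1) / (1 - l n) / real n"
    using eventually_gt_at_top[of 0] by eventually_elim (simp add: field_simps)
  ultimately have "(\<lambda>n. (real n - R n (l n) + 1) / (1 - l n) / real n)
      \<longlonglongrightarrow> (1 - G \<nu> + 0) / (1 - \<nu>)"
    by (rule Lim_transform_eventually)
  then show ?thesis by simp
qed

text \<open>The constant \<open>c\<close> is the limit of the estimated proportion of nulls. It is
  nonnegative because at most \<open>n\<close> hypotheses are rejected, and at most 1 because the
  ratio is at most 1 at \<open>\<nu>\<close>; hence the adaptive limit threshold is the larger
  one.\<close>

lemma attained_limits:
  assumes l: "l \<longlonglongrightarrow> \<nu>" "\<forall>\<^sub>F n in sequentially. l n \<in> {0<..u}"
    and \<nu>: "\<nu> \<in> {0<..u}" "\<nu> < 1"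
    and \<alpha>: "0 < \<alpha>" and b: "0 \<le> b"
    and ratio_le: "u / G u \<le> 1"
    and R_le: "\<And>n. R n \<nu> \<le> real n"
  defines "A \<equiv> \<lambda>n. (real n - R n (l n) + 1) / (1 - l n)"
    and "c \<equiv> (1 - G \<nu>) / (1 - \<nu>)"
  obtains t\<^sub>0 t\<^sub>1 where
    "(\<lambda>n. V n (threshold real \<alpha> n) / max (R n (threshold real \<alpha> n)) 1) \<longlonglongrightarrow> b * (t\<^sub>0 / G t\<^sub>0)"
    "(\<lambda>n. V n (threshold A \<alpha> n) / max (R n (threshold A \<alpha> n)) 1) \<longlonglongrightarrow> b * (t\<^sub>1 / G t\<^sub>1)"
    "b * (t\<^sub>0 / G t\<^sub>0) \<le> b * (t\<^sub>1 / G t\<^sub>1)"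
    "t\<^sub>1 \<in> {0<..u}" "c * (t\<^sub>1 / G t\<^sub>1) \<le> \<alpha>" "t\<^sub>1 = u \<or> c * (t\<^sub>1 / G t\<^sub>1) = \<alpha>"
proof -
  have "G \<nu> \<le> 1"
  proof (rule LIMSEQ_le_const2)
    show "(\<lambda>n. R n \<nu> / real n) \<longlonglongrightarrow> G \<nu>"
      using R_seq[OF filterlim_ident \<nu>(1) tendsto_const] \<nu>(1) by auto
    show "\<exists>k. \<forall>n\<ge>k. R n \<nu> / real n \<le> 1"
      using R_le by (intro exI[of _ 1]) (auto simp: divide_simps)
  qed
  then have c0: "0 \<le> c" using \<nu> by (simp add: c_def)
  have "\<nu> / G \<nu> \<le> 1"
    using ratio_less[of \<nu> u] ratio_le \<nu> by (cases "\<nu> = u") auto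
  then have "\<nu> \<le> G \<nu>" using G_pos[of \<nu>] \<nu> by (simp add: divide_simps)
  then have c1: "c \<le> 1" using \<nu> by (simp add: c_def divide_simps)
  have A: "(\<lambda>n. A n / real n) \<longlonglongrightarrow> c"
    unfolding A_def c_def by (rule M0_hat_tendsto[OF l \<nu>])
  have id: "(\<lambda>n. real n / real n) \<longlonglongrightarrow> 1"
    by (rule tendsto_eventually) (use eventually_gt_at_top[of 0] in eventually_elim, simp)
  obtain t\<^sub>0 where t0: "t\<^sub>0 \<in> {0<..u}" "1 * (t\<^sub>0 / G t\<^sub>0) \<le> \<alpha>" "t\<^sub>0 = u \<or> 1 * (t\<^sub>0 / G t\<^sub>0) = \<alpha>"
    using limit_threshold_exists[OF \<alpha> zero_le_one] by blast
  obtain t\<^sub>1 where t1: "t\<^sub>1 \<in> {0<..u}" "c * (t\<^sub>1 / G t\<^sub>1) \<le> \<alpha>" "t\<^sub>1 = u \<or> c * (t\<^sub>1 / G t\<^sub>1) = \<alpha>"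
    using limit_threshold_exists[OF \<alpha> c0] by blast
  have "t\<^sub>0 / G t\<^sub>0 \<le> t\<^sub>1 / G t\<^sub>1"
  proof (rule ccontr)
    \<comment> \<open>Otherwise \<open>t\<^sub>1 < t\<^sub>0 \<le> u\<close>, so the bound is
      attained at \<open>t\<^sub>1\<close>. Then \<open>\<alpha>\<close> is at most the ratio at
      \<open>t\<^sub>1\<close>, which is smaller than the ratio at \<open>t\<^sub>0\<close>, itself
      at most \<open>\<alpha>\<close>.\<close>
    assume less: "\<not> ?thesis"
    then have "t\<^sub>1 < t\<^sub>0"
      using ratio_less[of t\<^sub>0 t\<^sub>1] t0(1) t1(1) by (cases "t\<^sub>0 = t\<^sub>1") force+
    then have "\<alpha> = c * (t\<^sub>1 / G t\<^sub>1)" using t0(1) t1(3) by auto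
    also have "\<dots> \<le> 1 * (t\<^sub>1 / G t\<^sub>1)"
      using c1 ratio_pos[of t\<^sub>1] t1(1) by (intro mult_right_mono) auto
    finally show False using less t0(2) by simp
  qed
  then show ?thesis
    using that attained_tendsto[OF id \<alpha> zero_le_one t0] attained_tendsto[OF A \<alpha> c0 t1] t1 b
    by (blast intro: mult_left_mono)
qed

end

section \<open>Counting rejections\<close>

text \<open>Positive weights preserve the order of the sizes. Splitting the sum at \<open>N\<close>,
  each alternative contributes at most 1, and exactly 1 if all alternatives are rejected. The
  hypotheses cover all of \<open>{0..}\<close> because \<open>t * w m\<close> may exceed 1.\<close>

lemma
  fixes D :: "nat \<Rightarrow> real \<Rightarrow> real"
  assumes D: "\<And>m. m \<in> {1..M} \<Longrightarrow> mono_on {0..} (D m)"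
      "\<And>m t. m \<in> {1..M} \<Longrightarrow> 0 \<le> t \<Longrightarrow> D m t \<in> {0, 1}"
    and w: "\<And>m. m \<in> {1..M} \<Longrightarrow> 0 < w m"
    and N: "N \<subseteq> {1..M}"
  shows rejections_mono: "mono_on {0..} (rejections D M w)"
    and false_rejections_mono: "mono_on {0..} (false_rejections D N w)"
    and rejections_le: "0 \<le> t \<Longrightarrow> rejections D M w t \<le> real M"
    and rejections_le_false_rejections:
      "0 \<le> t \<Longrightarrow> rejections D M w t \<le> false_rejections D N w t + (real M - real (card N))"
    and rejections_eq_false_rejections:
      "0 < t \<Longrightarrow> (\<And>m s. m \<in> {1..M} - N \<Longrightarrow> 0 < s \<Longrightarrow> D m s = 1) \<Longrightarrow>
        rejections D M w t = false_rejections D N w t + (real M - real (card N))"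
proof -
  have "D m (s * w m) \<le> D m (t * w m)" if "m \<in> {1..M}" "0 \<le> s" "s \<le> t" for m s t
    using w[OF that(1)] that by (intro mono_onD[OF D(1)]) (auto intro: mult_right_mono)
  then show "mono_on {0..} (rejections D M w)" "mono_on {0..} (false_rejections D N w)"
    unfolding rejections_def false_rejections_def using N by (auto intro!: mono_onI sum_mono)
  have le1: "D m (t * w m) \<le> 1" if "0 \<le> t" "m \<in> {1..M}" for m t
    using D(2)[of m "t * w m"] w[OF that(2)] that by auto
  show "rejections D M w t \<le> real M" if "0 \<le> t"
    using sum_mono[of "{1..M}" "\<lambda>m. D m (t * w m)" "\<lambda>_. 1"] le1[OF that]
    unfolding rejections_def by simp
  have split: "rejections D M w t = false_rejections D N w t + (\<Sum>m\<in>{1..M} - N. D m (t * w m))" for t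
    unfolding rejections_def false_rejections_def using N by (simp add: sum.subset_diff)
  have card: "real (card ({1..M} - N)) = real M - real (card N)"
    using N card_mono[OF _ N] by (simp add: card_Diff_subset finite_subset[OF N] of_nat_diff)
  show "rejections D M w t \<le> false_rejections D N w t + (real M - real (card N))" if "0 \<le> t"
    using sum_mono[of "{1..M} - N" "\<lambda>m. D m (t * w m)" "\<lambda>_. 1"] le1[OF that] card split[of t] by simp
  show "rejections D M w t = false_rejections D N w t + (real M - real (card N))"
    if "0 < t" "\<And>m s. m \<in> {1..M} - N \<Longrightarrow> 0 < s \<Longrightarrow> D m s = 1"
  proof -
    have "(\<Sum>m\<in>{1..M} - N. D m (t * w m)) = (\<Sum>m\<in>{1..M} - N. 1)"
      using that w by (intro sum.cong) auto
    then show ?thesis using card split[of t] by simp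
  qed
qed

section \<open>Almost sure properties of the decisions\<close>

context weighted_testing
begin

text \<open>Almost surely the decision at size 1 is 1, so the p-value is at most 1 and the extension
  is constantly 1 beyond size 1. Both branches then fit together monotonically, on one null set for
  all countably many pairs of \<open>M\<close> and \<open>m\<close>.\<close>

lemma decisions_regular:
  "AE \<omega> in P. \<forall>M. \<forall>m\<in>{1..M}. mono_on {0..} (decisions \<delta> Z M \<omega> m) \<and>
     (\<forall>t\<ge>0. decisions \<delta> Z M \<omega> m t \<in> {0, 1})"
proof -
  have "AE \<omega> in P. mono_on {0..} (decisions \<delta> Z M \<omega> m) \<and>
     (\<forall>t\<ge>0. decisions \<delta> Z M \<omega> m t \<in> {0, 1})" if m: "m \<in> {1..M}" for M m
    using decision_mono[OF m] decision_at_1[OF m] AE_space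
  proof eventually_elim
    case (elim \<omega>)
    let ?d = "\<delta> M m (Z M m \<omega>)"
    have "Z M m \<omega> \<in> space (S M m)" using measurable_space[OF statistic[OF m] elim(3)] .
    then have d01: "?d t \<in> {0, 1}" if "t \<in> {0..1}" for t using decision_01[OF m _ that] by blast
    have "p_value (\<delta> M m) (Z M m \<omega>) \<le> 1"
      unfolding p_value_def using elim(2) by (intro cInf_lower) (auto simp: bdd_below_def)
    then have D: "decisions \<delta> Z M \<omega> m t = (if t \<le> 1 then ?d t else 1)" for t
      by (simp add: decisions_def decide_def)
    have D01: "decisions \<delta> Z M \<omega> m t \<in> {0, 1}" if "0 \<le> t" for t
      using d01[of t] that D[of t] by auto
    have "mono_on {0..} (decisions \<delta> Z M \<omega> m)"
    proof (rule mono_onI)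
      fix s t :: real assume st: "s \<in> {0..}" "t \<in> {0..}" "s \<le> t"
      show "decisions \<delta> Z M \<omega> m s \<le> decisions \<delta> Z M \<omega> m t"
      proof (cases "t \<le> 1")
        case True
        then show ?thesis using mono_onD[OF elim(1), of s t] st by (simp add: D)
      next
        case False
        then show ?thesis using D01[of s] st D[of t] by auto
      qed
    qed
    with D01 show ?case by blast
  qed
  then have "\<forall>M. AE \<omega> in P. \<forall>m\<in>{1..M}. mono_on {0..} (decisions \<delta> Z M \<omega> m) \<and>
     (\<forall>t\<ge>0. decisions \<delta> Z M \<omega> m t \<in> {0, 1})"
    by - (rule allI, rule AE_finite_allI, simp_all)
  then show ?thesis by (rule AE_all_countable[THEN iffD2])
qed

text \<open>A 0-1 variable with expectation 1 is almost surely 1. Applying this at rational sizes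
  costs one null set, and monotonicity covers every positive size.\<close>

lemma dirac_uniform_decisions:
  assumes du: "dirac_uniform P Z \<delta> N"
  shows "AE \<omega> in P. \<forall>M. \<forall>m\<in>{1..M} - N M. \<forall>t>0. decisions \<delta> Z M \<omega> m t = 1"
proof -
  have one: "AE \<omega> in P. \<delta> M m (Z M m \<omega>) q = 1"
    if m: "m \<in> {1..M} - N M" and q: "q \<in> {0<..1}" for M m q
  proof -
    have m': "m \<in> {1..M}" and q': "q \<in> {0..1}" using m q by auto
    have [measurable]: "(\<lambda>\<omega>. \<delta> M m (Z M m \<omega>) q) \<in> borel_measurable P"
      using measurable_compose[OF statistic[OF m'] decision_measurable[OF m' q']] .
    have val: "\<delta> M m (Z M m \<omega>) q \<in> {0, 1}" if "\<omega> \<in> space P" for \<omega>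
      using decision_01[OF m' measurable_space[OF statistic[OF m'] that] q'] .
    then have bounded: "AE \<omega> in P. norm (\<delta> M m (Z M m \<omega>) q) \<le> 1"
      by (intro AE_I2) force
    have int: "integrable P (\<lambda>\<omega>. \<delta> M m (Z M m \<omega>) q)"
      by (rule integrable_const_bound[OF bounded]) measurable
    have "expectation (\<lambda>\<omega>. \<delta> M m (Z M m \<omega>) q) = 1"
      using du m q unfolding dirac_uniform_def by auto
    then have "expectation (\<lambda>\<omega>. 1 - \<delta> M m (Z M m \<omega>) q) = 0"
      using int by (simp add: prob_space)
    moreover have "AE \<omega> in P. 0 \<le> 1 - \<delta> M m (Z M m \<omega>) q"
      using val by (intro AE_I2) force
    ultimately have "AE \<omega> in P. 1 - \<delta> M m (Z M m \<omega>) q = 0"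
      using integral_nonneg_eq_0_iff_AE[of P "\<lambda>\<omega>. 1 - \<delta> M m (Z M m \<omega>) q"] int by simp
    then show ?thesis by eventually_elim simp
  qed
  have "AE \<omega> in P. \<forall>q\<in>{0<..1} \<inter> \<rat>. \<delta> M m (Z M m \<omega>) q = 1"
    if "m \<in> {1..M} - N M" for M m
    by (rule AE_ball_countable[THEN iffD2]) (use one[OF that] in \<open>auto simp: countable_rat\<close>)
  then have "\<forall>M. AE \<omega> in P. \<forall>m\<in>{1..M} - N M. \<forall>q\<in>{0<..1} \<inter> \<rat>. \<delta> M m (Z M m \<omega>) q = 1"
    by - (rule allI, rule AE_finite_allI, simp_all)
  then have "AE \<omega> in P. \<forall>M. \<forall>m\<in>{1..M} - N M. \<forall>q\<in>{0<..1} \<inter> \<rat>. \<delta> M m (Z M m \<omega>) q = 1"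
    by (rule AE_all_countable[THEN iffD2])
  then show ?thesis
    using decisions_regular
  proof eventually_elim
    case (elim \<omega>)
    show ?case
    proof (intro allI ballI impI)
      fix M m and t :: real assume m: "m \<in> {1..M} - N M" and t: "0 < t"
      \<comment> \<open>The minimum with 1 is needed because the expectations are prescribed only
        for sizes in \<open>(0,1]\<close>, while \<open>t\<close> may be larger.\<close>
      obtain q where q: "q \<in> \<rat>" "0 < q" "q < min t 1"
        using Rats_dense_in_real[of 0 "min t 1"] t by auto
      have "decisions \<delta> Z M \<omega> m q = 1"
        using elim(1) m q by (auto simp: decisions_def decide_def)
      moreover have "decisions \<delta> Z M \<omega> m q \<le> decisions \<delta> Z M \<omega> m t"
        using mono_onD[of "{0..}" "decisions \<delta> Z M \<omega> m" q t] elim(2) m q t by simp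
      moreover have "decisions \<delta> Z M \<omega> m t \<in> {0, 1}" using elim(2) m t by auto
      ultimately show "decisions \<delta> Z M \<omega> m t = 1" by auto
    qed
  qed
qed

end

section \<open>Asymptotic control of the false discovery proportion\<close>

theorem theorem5:
  fixes P :: "'a measure"
    and S :: "nat \<Rightarrow> nat \<Rightarrow> 'z measure"
    and Z :: "nat \<Rightarrow> nat \<Rightarrow> 'a \<Rightarrow> 'z"
    and \<delta> :: "nat \<Rightarrow> nat \<Rightarrow> 'z \<Rightarrow> real \<Rightarrow> real"
    and N :: "nat \<Rightarrow> nat set"
    and w :: "nat \<Rightarrow> 'a \<Rightarrow> nat \<Rightarrow> real"
    and lam :: "nat \<Rightarrow> 'a \<Rightarrow> real"
    and G :: "real \<Rightarrow> real"
    and \<alpha> lam_lim k u a0 \<mu>0 :: real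
  assumes testing: "weighted_testing P S Z \<delta> N w lam"
    and \<alpha>: "0 < \<alpha>" "\<alpha> < 1"
    and A2_const: "0 < lam_lim" "lam_lim < 1" "lam_lim \<le> u" "u = 1 / k"
    and A2_lam: "AE \<omega> in P. (\<lambda>M. lam M \<omega>) \<longlonglongrightarrow> lam_lim \<and> (\<forall>\<^sub>F M in sequentially. lam M \<omega> \<le> u)"
    and A2_weights: "AE \<omega> in P. \<exists>l\<le>k. (\<lambda>M. Max (w M \<omega> ` {1..M})) \<longlonglongrightarrow> l"
    and A4: "\<And>t. 0 < t \<Longrightarrow> t \<le> u \<Longrightarrow>
      AE \<omega> in P. (\<lambda>M. rejections (decisions \<delta> Z M \<omega>) M (w M \<omega>) t / real M) \<longlonglongrightarrow> G t"
    and A5_const: "0 < \<mu>0" "0 < a0" "a0 < 1"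
    and A5: "\<And>t. 0 < t \<Longrightarrow> t \<le> u \<Longrightarrow>
      AE \<omega> in P. (\<lambda>M. false_rejections (decisions \<delta> Z M \<omega>) (N M) (w M \<omega>) t / real M)
        \<longlonglongrightarrow> a0 * \<mu>0 * t"
    and A5_weights: "AE \<omega> in P. (\<lambda>M. (\<Sum>m\<in>N M. w M \<omega> m) / real (card (N M))) \<longlonglongrightarrow> \<mu>0"
    and A5_nulls: "(\<lambda>M. real (card (N M)) / real M) \<longlonglongrightarrow> a0"
    and A6_mono: "strict_mono_on {0<..<u} (\<lambda>t. t / G t)"
    and A6_cont: "continuous_on {0<..<u} (\<lambda>t. t / G t)"
    and A6_at_0: "((\<lambda>t. t / G t) \<longlongrightarrow> 0) (at_right 0)"
    and A6_at_u: "((\<lambda>t. t / G t) \<longlongrightarrow> u / G u) (at_left u)" "u / G u \<le> 1"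
  shows
    "(AE \<omega> in P.
        convergent (\<lambda>M. procedure_FDP0 \<delta> Z N w u \<alpha> M \<omega>) \<and>
        convergent (\<lambda>M. procedure_FDP \<delta> Z N w lam u \<alpha> M \<omega>) \<and>
        lim (\<lambda>M. procedure_FDP0 \<delta> Z N w u \<alpha> M \<omega>)
          \<le> lim (\<lambda>M. procedure_FDP \<delta> Z N w lam u \<alpha> M \<omega>)) \<and>
     (\<mu>0 \<le> 1 \<longrightarrow>
      (AE \<omega> in P.
        convergent (\<lambda>M. procedure_FDP \<delta> Z N w lam u \<alpha> M \<omega>) \<and>
        lim (\<lambda>M. procedure_FDP \<delta> Z N w lam u \<alpha> M \<omega>) \<le> \<alpha>)) \<and>
     (\<mu>0 = 1 \<and> 0 < \<alpha> \<and> \<alpha> \<le> FDP_inf a0 \<mu>0 G u \<and> dirac_uniform P Z \<delta> N \<longrightarrow>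
      (AE \<omega> in P.
        convergent (\<lambda>M. procedure_FDP \<delta> Z N w lam u \<alpha> M \<omega>) \<and>
        lim (\<lambda>M. procedure_FDP \<delta> Z N w lam u \<alpha> M \<omega>) = \<alpha>))"
proof -
  interpret weighted_testing P S Z \<delta> N w lam by (rule testing)
  let ?R = "\<lambda>\<omega> M. rejections (decisions \<delta> Z M \<omega>) M (w M \<omega>)"
  let ?V = "\<lambda>\<omega> M. false_rejections (decisions \<delta> Z M \<omega>) (N M) (w M \<omega>)"
  \<comment> \<open>The point \<open>u\<close> is added separately since it may be
    irrational.\<close>
  let ?Q = "{0<..u} \<inter> (\<rat> \<union> {u})"
  define c where "c = (1 - G lam_lim) / (1 - lam_lim)"
  have lam_lim: "lam_lim \<in> {0<..u}" using A2_const by simp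
  have u: "0 < u" using A2_const(1,3) by linarith
  interpret limiting_ratio G u
    using u A6_mono A6_cont A6_at_0 A6_at_u(1) by unfold_locales
  have b: "0 \<le> a0 * \<mu>0" using A5_const by simp
  have Q: "countable ?Q" using countable_rat by (intro countable_Int2) auto
  have R_lim: "AE \<omega> in P. \<forall>q\<in>?Q. (\<lambda>M. ?R \<omega> M q / real M) \<longlonglongrightarrow> G q"
    using A4 by (intro AE_ball_countable[THEN iffD2, OF Q]) auto
  have V_lim: "AE \<omega> in P. \<forall>q\<in>?Q. (\<lambda>M. ?V \<omega> M q / real M) \<longlonglongrightarrow> a0 * \<mu>0 * q"
    using A5 by (intro AE_ball_countable[THEN iffD2, OF Q]) auto
  \<comment> \<open>Here \<open>L\<close> is the limit for the unadaptive threshold and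
    \<open>t\<close> the limit of the adaptive one. The facts recorded about \<open>t\<close> are
    those from which (C2) and (C3) are read off.\<close>
  have limits: "AE \<omega> in P. \<exists>L t. (\<lambda>M. procedure_FDP0 \<delta> Z N w u \<alpha> M \<omega>) \<longlonglongrightarrow> L \<and>
      (\<lambda>M. procedure_FDP \<delta> Z N w lam u \<alpha> M \<omega>) \<longlonglongrightarrow> a0 * \<mu>0 * (t / G t) \<and>
      L \<le> a0 * \<mu>0 * (t / G t) \<and> t \<in> {0<..u} \<and>
      c * (t / G t) \<le> \<alpha> \<and> (t = u \<or> c * (t / G t) = \<alpha>)"
    using decisions_regular R_lim V_lim A2_lam AE_space
  proof eventually_elim
    case (elim \<omega>)
    note D = elim(1)[rule_format, THEN conjunct1] elim(1)[rule_format, THEN conjunct2, rule_format]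
    note W = weight_pos[OF _ elim(5)]
    interpret testing_path G u "?R \<omega>" "?V \<omega>" "a0 * \<mu>0"
    proof
      show "mono_on {0<..u} (?R \<omega> n)" for n
        by (rule mono_on_subset[OF rejections_mono[OF D W nulls]]) auto
      show "mono_on {0<..u} (?V \<omega> n)" for n
        by (rule mono_on_subset[OF false_rejections_mono[OF D W nulls]]) auto
    qed (use elim(2,3) in auto)
    have l: "(\<lambda>M. lam M \<omega>) \<longlonglongrightarrow> lam_lim" using elim(4) by simp
    have "\<forall>\<^sub>F M in sequentially. lam M \<omega> \<in> {0<..u}"
      using elim(4) lam_bounds[OF elim(5)] by (auto elim: eventually_mono)
    note attained = attained_limits[OF l this lam_lim A2_const(2) \<alpha>(1) b A6_at_u(2)]
    have R_le: "?R \<omega> n lam_lim \<le> real n" for n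
      using rejections_le[OF D W nulls] lam_lim by auto
    show ?case
      using attained[OF R_le]
      unfolding procedure_FDP0_def procedure_FDP_def FDP_def t_hat0_def t_hat_def FDP_hat0_def
        FDP_hat_def M0_hat_def threshold_def c_def
      by blast
  qed
  have R_at: "AE \<omega> in P. (\<lambda>M. ?R \<omega> M lam_lim / real M) \<longlonglongrightarrow> G lam_lim"
    and V_at: "AE \<omega> in P. (\<lambda>M. ?V \<omega> M lam_lim / real M) \<longlonglongrightarrow> a0 * \<mu>0 * lam_lim"
    using A4 A5 lam_lim by auto
  \<comment> \<open>False rejections plus the number of alternatives: an upper bound for all
    rejections in general, and their exact number under a Dirac Uniform distribution.\<close>
  have V_plus: "(\<lambda>M. (?V \<omega> M lam_lim + (real M - real (card (N M)))) / real M)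
      \<longlonglongrightarrow> a0 * \<mu>0 * lam_lim + (1 - a0)"
    if "(\<lambda>M. ?V \<omega> M lam_lim / real M) \<longlonglongrightarrow> a0 * \<mu>0 * lam_lim" for \<omega>
  proof (rule Lim_transform_eventually)
    show "(\<lambda>M. ?V \<omega> M lam_lim / real M + (1 - real (card (N M)) / real M))
        \<longlonglongrightarrow> a0 * \<mu>0 * lam_lim + (1 - a0)"
      by (intro tendsto_intros that A5_nulls)
    show "\<forall>\<^sub>F M in sequentially. ?V \<omega> M lam_lim / real M + (1 - real (card (N M)) / real M)
        = (?V \<omega> M lam_lim + (real M - real (card (N M)))) / real M"
      using eventually_gt_at_top[of 0] by eventually_elim (simp add: field_simps)
  qed
  have "AE \<omega> in P. G lam_lim \<le> a0 * \<mu>0 * lam_lim + (1 - a0)"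
    using decisions_regular R_at V_at AE_space
  proof eventually_elim
    case (elim \<omega>)
    note D = elim(1)[rule_format, THEN conjunct1] elim(1)[rule_format, THEN conjunct2, rule_format]
    note W = weight_pos[OF _ elim(4)]
    have "?R \<omega> M lam_lim \<le> ?V \<omega> M lam_lim + (real M - real (card (N M)))" for M
      using rejections_le_false_rejections[OF D W nulls] lam_lim by auto
    then show ?case
      by (intro LIMSEQ_le[OF elim(2) V_plus[OF elim(3)]] exI allI impI divide_right_mono) simp_all
  qed
  \<comment> \<open>The inequality does not involve the outcome, so holding almost surely in a
    probability space it holds outright.\<close>
  then have G_le: "G lam_lim \<le> a0 * \<mu>0 * lam_lim + (1 - a0)" by simp
  have C1: "AE \<omega> in P. convergent (\<lambda>M. procedure_FDP0 \<delta> Z N w u \<alpha> M \<omega>) \<and>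
      convergent (\<lambda>M. procedure_FDP \<delta> Z N w lam u \<alpha> M \<omega>) \<and>
      lim (\<lambda>M. procedure_FDP0 \<delta> Z N w u \<alpha> M \<omega>) \<le> lim (\<lambda>M. procedure_FDP \<delta> Z N w lam u \<alpha> M \<omega>)"
    using limits by eventually_elim (auto simp: limI convergentI)
  have C2: "AE \<omega> in P. convergent (\<lambda>M. procedure_FDP \<delta> Z N w lam u \<alpha> M \<omega>) \<and>
      lim (\<lambda>M. procedure_FDP \<delta> Z N w lam u \<alpha> M \<omega>) \<le> \<alpha>" if "\<mu>0 \<le> 1"
  proof -
    have le: "a0 * \<mu>0 \<le> a0"
      using mult_left_mono[OF that, of a0] A5_const by simp
    then have "a0 * \<mu>0 * lam_lim \<le> a0 * lam_lim"
      using A2_const(1) by (intro mult_right_mono) auto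
    then have "a0 * (1 - lam_lim) \<le> 1 - G lam_lim" using G_le by (simp add: algebra_simps)
    \<comment> \<open>Dividing by \<open>1 - lam_lim\<close>: asymptotically the proportion of nulls
      is not underestimated.\<close>
    then have "a0 \<le> c" using A2_const(2) by (simp add: c_def pos_le_divide_eq)
    with le have bc: "a0 * \<mu>0 \<le> c" by simp
    show ?thesis
      using limits
    proof eventually_elim
      case (elim \<omega>)
      then obtain t where t: "(\<lambda>M. procedure_FDP \<delta> Z N w lam u \<alpha> M \<omega>) \<longlonglongrightarrow> a0 * \<mu>0 * (t / G t)"
          "t \<in> {0<..u}" "c * (t / G t) \<le> \<alpha>"
        by blast
      have "a0 * \<mu>0 * (t / G t) \<le> c * (t / G t)"
        using bc ratio_pos[of t] t(2) by (intro mult_right_mono) auto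
      then show ?case using t limI[OF t(1)] by (auto intro: convergentI)
    qed
  qed
  have C3: "AE \<omega> in P. convergent (\<lambda>M. procedure_FDP \<delta> Z N w lam u \<alpha> M \<omega>) \<and>
      lim (\<lambda>M. procedure_FDP \<delta> Z N w lam u \<alpha> M \<omega>) = \<alpha>"
    if \<mu>0: "\<mu>0 = 1" and \<alpha>_le: "\<alpha> \<le> FDP_inf a0 \<mu>0 G u" and du: "dirac_uniform P Z \<delta> N"
  proof -
    have "AE \<omega> in P. G lam_lim = a0 * \<mu>0 * lam_lim + (1 - a0)"
      using decisions_regular dirac_uniform_decisions[OF du] R_at V_at AE_space
    proof eventually_elim
      case (elim \<omega>)
      note D = elim(1)[rule_format, THEN conjunct1] elim(1)[rule_format, THEN conjunct2, rule_format]
      note W = weight_pos[OF _ elim(5)]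
      have "?R \<omega> M lam_lim = ?V \<omega> M lam_lim + (real M - real (card (N M)))" for M
        using rejections_eq_false_rejections[where t = lam_lim, OF D W nulls] elim(2) lam_lim by auto
      then show ?case using LIMSEQ_unique[OF elim(3)] V_plus[OF elim(4)] by simp
    qed
    then have "G lam_lim = a0 * \<mu>0 * lam_lim + (1 - a0)" by simp
    then have "1 - G lam_lim = a0 * (1 - lam_lim)" using \<mu>0 by (simp add: algebra_simps)
    then have c: "c = a0" using A2_const(2) by (simp add: c_def)
    show ?thesis
      using limits
    proof eventually_elim
      case (elim \<omega>)
      then obtain t where t: "(\<lambda>M. procedure_FDP \<delta> Z N w lam u \<alpha> M \<omega>) \<longlonglongrightarrow> a0 * \<mu>0 * (t / G t)"
          "c * (t / G t) \<le> \<alpha>" "t = u \<or> c * (t / G t) = \<alpha>"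
        by blast
      \<comment> \<open>If \<open>t = u\<close>, the assumption
        \<open>\<alpha> \<le> FDP_inf a0 \<mu>0 G u\<close> supplies the reverse of
        \<open>c * (t / G t) \<le> \<alpha>\<close>; otherwise equality already holds, as
        \<open>c = a0\<close> and \<open>\<mu>0 = 1\<close>.\<close>
      have "a0 * \<mu>0 * (t / G t) = \<alpha>"
        using t(2,3) \<alpha>_le c \<mu>0 by (auto simp: FDP_inf_def)
      then show ?case using t limI[OF t(1)] by (auto intro: convergentI)
    qed
  qed
  from C1 C2 C3 show ?thesis by blast
qed

end
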